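(* Let $n\ge 1$. (i) Let $u:\mathbb{R}\times\mathbb{R}^n\to\mathbb{R}$ be of the form $$u(t,x)=at^2+t\,b(x)+g(x),$$ where $a>0$ is a constant, $b:\mathbb{R}^n\to\mathbb{R}$ is a harmonic function, and $g:\mathbb{R}^n\to\mathbb{R}$ is a smooth function satisfying $$\triangle g=\frac{1}{2a}\left(1+|\nabla b|^2\right)\quad\text{on }\mathbb{R}^n.$$ Then $u$ is an entire solution of Donaldson's equation $u_{tt}\triangle u-|\nabla u_t|^2=1$. (ii) Moreover, any entire solution $u$ of Donaldson's equation on $\mathbb{R}\times\mathbb{R}^n$ such that $u_{tt}$ is constant has the form $u(t,x)=at^2+t\,b(x)+g(x)$ for some constant $a>0$ and some functions $b,g:\mathbb{R}^n\to\mathbb{R}$.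
   Context: Points of $\mathbb{R}\times\mathbb{R}^n$ are written $(t,x)$. For a function of $(t,x)$, $\nabla$ and $\triangle$ denote the gradient and Laplacian with respect to the variable $x\in\mathbb{R}^n$ only, and $u_t,u_{tt}$ denote derivatives in $t$. An entire solution of Donaldson's equation is a smooth function $u:\mathbb{R}\times\mathbb{R}^n\to\mathbb{R}$ with $u_{tt}>0$, $\triangle u>0$ and $$u_{tt}\triangle u-|\nabla u_t|^2=1$$ everywhere on $\mathbb{R}\times\mathbb{R}^n$. *)

theory Defs
  imports "HOL-Analysis.Analysis"
begin

text \<open>
  \<open>C_k k f\<close> says that \<open>f\<close> is of class $C^k$ on the whole space: it is Frechet differentiable
  and each directional derivative \<open>x \<mapsto> Df(x) v\<close> is of class $C^{k-1}$.  In finite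
  dimension this is the usual notion.
\<close>

primrec C_k :: "nat \<Rightarrow> ('a::euclidean_space \<Rightarrow> real) \<Rightarrow> bool" where
  "C_k 0 f \<longleftrightarrow> continuous_on UNIV f"
| "C_k (Suc k) f \<longleftrightarrow>
     (\<forall>x. f differentiable (at x)) \<and> (\<forall>v. C_k k (\<lambda>x. frechet_derivative f (at x) v))"

definition smooth :: "('a::euclidean_space \<Rightarrow> real) \<Rightarrow> bool" where
  "smooth f \<longleftrightarrow> (\<forall>k. C_k k f)"

definition partial_deriv :: "'n::finite \<Rightarrow> (real^'n \<Rightarrow> real) \<Rightarrow> real^'n \<Rightarrow> real" where
  "partial_deriv i f x = frechet_derivative f (at x) (axis i 1)"

definition gradient :: "(real^'n::finite \<Rightarrow> real) \<Rightarrow> real^'n \<Rightarrow> real^'n" where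
  "gradient f x = (\<chi> i. partial_deriv i f x)"

definition laplacian :: "(real^'n::finite \<Rightarrow> real) \<Rightarrow> real^'n \<Rightarrow> real" where
  "laplacian f x = (\<Sum>i\<in>UNIV. partial_deriv i (partial_deriv i f) x)"

text \<open>Only $C^2$ regularity is part of the definition.\<close>

definition harmonic :: "(real^'n::finite \<Rightarrow> real) \<Rightarrow> bool" where
  "harmonic f \<longleftrightarrow> C_k 2 f \<and> (\<forall>x. laplacian f x = 0)"

definition time_deriv :: "(real \<times> (real^'n::finite) \<Rightarrow> real) \<Rightarrow> real \<times> (real^'n) \<Rightarrow> real" where
  "time_deriv u = (\<lambda>(t, x). deriv (\<lambda>s. u (s, x)) t)"

definition space_gradient :: "(real \<times> (real^'n::finite) \<Rightarrow> real) \<Rightarrow> real \<times> (real^'n) \<Rightarrow> real^'n" where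
  "space_gradient u = (\<lambda>(t, x). gradient (\<lambda>y. u (t, y)) x)"

definition space_laplacian :: "(real \<times> (real^'n::finite) \<Rightarrow> real) \<Rightarrow> real \<times> (real^'n) \<Rightarrow> real" where
  "space_laplacian u = (\<lambda>(t, x). laplacian (\<lambda>y. u (t, y)) x)"

definition entire_donaldson_solution :: "(real \<times> (real^'n::finite) \<Rightarrow> real) \<Rightarrow> bool" where
  "entire_donaldson_solution u \<longleftrightarrow>
     smooth u \<and>
     (\<forall>p. time_deriv (time_deriv u) p > 0 \<and>
          space_laplacian u p > 0 \<and>
          time_deriv (time_deriv u) p * space_laplacian u p
            - (norm (space_gradient (time_deriv u) p))\<^sup>2 = 1)"

end

theory Submission
  imports Defs
begin

text \<open>
  The equation itself is a direct computation in both directions. What needs an argument is that \<open>u\<close>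
  is smooth in the first part, where the harmonic function \<open>b\<close> is only assumed to be $C^2$. With the
  compactly supported $C^1$ kernel $K(y) = \max(0, 1 - |y|^2)^2$, a mean value identity expresses
  \<open>b\<close> as a constant multiple of $\int b(x + y) K(y)\,dy$. Differentiating and integrating by parts turns
  $\partial_v b$ into a multiple of $\int b(x + y)\, \partial_v K(y)\,dy$, which has the same
  regularity as \<open>b\<close>; hence \<open>b\<close> gains one derivative at a time.
\<close>

section \<open>Calculus of functions of class $C^k$\<close>

abbreviation dir_deriv :: "'a \<Rightarrow> ('a::euclidean_space \<Rightarrow> real) \<Rightarrow> 'a \<Rightarrow> real" where
  "dir_deriv v f \<equiv> \<lambda>x. frechet_derivative f (at x) v"

lemma has_derivative_frechet:
  assumes "C_k (Suc k) f"
  shows "(f has_derivative frechet_derivative f (at x)) (at x)"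
  using assms by (simp add: frechet_derivative_works[symmetric])

text \<open>Frechet derivatives are unique, so any explicit derivative \<open>f'\<close> may stand
  in for \<open>frechet_derivative f\<close>. The closure properties below go through this
  rule.\<close>

lemma C_k_Suc_I:
  assumes "\<And>x. (f has_derivative f' x) (at x)" "\<And>v. C_k k (\<lambda>x. f' x v)"
  shows "C_k (Suc k) f"
proof -
  have "frechet_derivative f (at x) = f' x" for x
    using assms(1) frechet_derivative_at by metis
  then show ?thesis
    using assms by (auto simp: differentiable_def)
qed

lemma C_k_dir_deriv: "C_k (Suc k) f \<Longrightarrow> C_k k (dir_deriv v f)"
  by simp

lemma C_k_SucD: "C_k (Suc k) f \<Longrightarrow> C_k k f"
proof (induction k arbitrary: f)
  case 0
  then show ?case
    by (auto intro!: continuous_at_imp_continuous_on differentiable_imp_continuous_within)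
next
  case (Suc k)
  have "C_k k (dir_deriv v f)" for v
    by (rule Suc.IH[OF C_k_dir_deriv[OF Suc.prems]])
  moreover have "\<forall>x. f differentiable (at x)"
    using Suc.prems by simp
  ultimately show ?case by simp
qed

lemma C_k_continuous: "C_k k f \<Longrightarrow> continuous_on UNIV f"
  by (induction k) (auto dest: C_k_SucD simp del: C_k.simps(2))

lemma C_k_continuous_on: "C_k k f \<Longrightarrow> continuous_on S f"
  using C_k_continuous continuous_on_subset by blast

lemma C_k_const: "C_k k (\<lambda>x. c)"
proof (induction k arbitrary: c)
  case (Suc k)
  show ?case
    by (rule C_k_Suc_I[where f' = "\<lambda>x v. 0"]) (auto intro!: Suc)
qed simp

lemma C_k_linear: "bounded_linear f \<Longrightarrow> C_k k f"
proof (cases k)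
  case 0
  assume "bounded_linear f"
  then show ?thesis
    using 0 by (simp add: linear_continuous_on)
next
  case (Suc m)
  assume "bounded_linear f"
  then show ?thesis
    unfolding Suc
    by (intro C_k_Suc_I[where f' = "\<lambda>x. f"]) (auto intro: bounded_linear_imp_has_derivative C_k_const)
qed

lemma C_k_add: "C_k k f \<Longrightarrow> C_k k g \<Longrightarrow> C_k k (\<lambda>x. f x + g x)"
proof (induction k arbitrary: f g)
  case 0
  then show ?case by (simp add: continuous_on_add)
next
  case (Suc k)
  show ?case
    by (rule C_k_Suc_I[OF has_derivative_add[OF has_derivative_frechet[OF Suc.prems(1)]
          has_derivative_frechet[OF Suc.prems(2)]]])
      (intro Suc.IH C_k_dir_deriv Suc.prems)
qed

lemma C_k_mult: "C_k k f \<Longrightarrow> C_k k g \<Longrightarrow> C_k k (\<lambda>x. f x * g x)"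
proof (induction k arbitrary: f g)
  case 0
  then show ?case by (simp add: continuous_on_mult)
next
  case (Suc k)
  show ?case
    by (rule C_k_Suc_I[OF has_derivative_mult[OF has_derivative_frechet[OF Suc.prems(1)]
          has_derivative_frechet[OF Suc.prems(2)]]])
      (intro C_k_add Suc.IH C_k_dir_deriv Suc.prems C_k_SucD[OF Suc.prems(1)] C_k_SucD[OF Suc.prems(2)])
qed

text \<open>One affine form serves translations (\<open>L\<close> the identity), dilations about a
  point, and the projection \<open>snd\<close>.\<close>

lemma C_k_compose_affine:
  assumes "bounded_linear L"
  shows "C_k k f \<Longrightarrow> C_k k (\<lambda>x. f (c + L x))"
proof (induction k arbitrary: f)
  case 0
  have "continuous_on UNIV (\<lambda>x. c + L x)"
    by (intro continuous_intros linear_continuous_on assms)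
  with 0 show ?case
    by (auto intro: continuous_on_compose2)
next
  case (Suc k)
  have "((\<lambda>x. c + L x) has_derivative L) (at x)" for x
    using assms by (auto intro!: derivative_eq_intros bounded_linear_imp_has_derivative)
  from has_derivative_compose[OF this has_derivative_frechet[OF Suc.prems]]
  show ?case
    by (rule C_k_Suc_I) (intro Suc.IH C_k_dir_deriv Suc.prems)
qed

lemma dir_deriv_compose_affine:
  assumes "bounded_linear L" "C_k (Suc k) f"
  shows "dir_deriv v (\<lambda>x. f (c + L x)) x = dir_deriv (L v) f (c + L x)"
proof -
  have "((\<lambda>x. c + L x) has_derivative L) (at x)"
    using assms by (auto intro!: derivative_eq_intros bounded_linear_imp_has_derivative)
  from has_derivative_compose[OF this has_derivative_frechet[OF assms(2)]]
  show ?thesis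
    by (simp add: frechet_derivative_at[symmetric])
qed

lemma dir_deriv_mult:
  assumes "C_k (Suc k) f" "C_k (Suc m) g"
  shows "dir_deriv v (\<lambda>x. f x * g x) x = f x * dir_deriv v g x + dir_deriv v f x * g x"
  using frechet_derivative_at[OF has_derivative_mult[OF has_derivative_frechet[OF assms(1)]
        has_derivative_frechet[OF assms(2)]], symmetric]
  by simp

text \<open>\<open>C_k\<close> controls one direction at a time, whereas differentiation under the
  integral sign needs a derivative that is continuous as an operator. In finite dimension continuity
  in each direction suffices.\<close>

lemma continuous_on_Blinfun_frechet:
  assumes "C_k (Suc k) f"
  shows "continuous_on S (\<lambda>x. Blinfun (frechet_derivative f (at x)))"
proof (rule continuous_on_blinfun_componentwise)
  fix i
  have "bounded_linear (frechet_derivative f (at x))" for x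
    using has_derivative_frechet[OF assms] has_derivative_bounded_linear by blast
  then show "continuous_on S (\<lambda>x. blinfun_apply (Blinfun (frechet_derivative f (at x))) i)"
    using C_k_continuous_on[OF C_k_dir_deriv[OF assms]] by (simp add: bounded_linear_Blinfun_apply)
qed

section \<open>Integrals with compact support\<close>

text \<open>The variable \<open>x\<close> enters through \<open>f\<close> alone, so derivatives in
  \<open>x\<close> fall on \<open>f\<close> and \<open>h\<close> need only be continuous. If
  \<open>h\<close> vanishes outside the box, this is the convolution of \<open>f\<close> with the
  reflected kernel.\<close>

definition conv_on :: "'a \<Rightarrow> 'a \<Rightarrow> ('a::euclidean_space \<Rightarrow> real) \<Rightarrow> ('a \<Rightarrow> real) \<Rightarrow> 'a \<Rightarrow> real" where
  "conv_on a b f h x = integral (cbox a b) (\<lambda>y. f (x + y) * h y)"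

lemma continuous_on_translate:
  fixes f :: "'a::real_normed_vector \<Rightarrow> 'b::topological_space"
  assumes "continuous_on UNIV f"
  shows "continuous_on S (\<lambda>y. f (x + y))"
  by (rule continuous_on_compose2[OF assms]) (auto intro!: continuous_intros)

lemma has_derivative_conv_on:
  assumes f: "C_k (Suc k) f" and h: "continuous_on UNIV h"
  shows "(conv_on a b f h has_derivative (\<lambda>v. conv_on a b (dir_deriv v f) h x)) (at x)"
proof -
  define F where "F x = Blinfun (frechet_derivative f (at x))" for x
  have F_apply: "blinfun_apply (F x) = frechet_derivative f (at x)" for x
    unfolding F_def using has_derivative_frechet[OF f] has_derivative_bounded_linear
    by (metis bounded_linear_Blinfun_apply)
  have F_cont: "continuous_on S F" for S
    unfolding F_def by (rule continuous_on_Blinfun_frechet[OF f])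
  have h': "continuous_on S h" for S
    using h continuous_on_subset by blast
  have f': "continuous_on UNIV f"
    using C_k_continuous[OF f] .
  have cont: "continuous_on (UNIV \<times> cbox a b) (\<lambda>(x, y). h y *\<^sub>R F (x + y))"
    unfolding split_beta
    by (intro continuous_intros continuous_on_compose2[OF F_cont[of UNIV]]
        continuous_on_compose2[OF h]) auto
  have "((\<lambda>x. integral (cbox a b) (\<lambda>y. f (x + y) * h y)) has_derivative
      blinfun_apply (integral (cbox a b) (\<lambda>y. h y *\<^sub>R F (x + y)))) (at x within UNIV)"
  proof (rule leibniz_rule[OF _ _ cont])
    fix x y :: 'a
    have "((\<lambda>x. x + y) has_derivative (\<lambda>v. v)) (at x)"
      by (auto intro!: derivative_eq_intros)
    from has_derivative_compose[OF this has_derivative_frechet[OF f]]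
    have "((\<lambda>x. f (x + y)) has_derivative F (x + y)) (at x)"
      by (simp add: F_apply)
    then show "((\<lambda>x. f (x + y) * h y) has_derivative blinfun_apply (h y *\<^sub>R F (x + y))) (at x within UNIV)"
      by (auto intro!: derivative_eq_intros simp: blinfun.scaleR_left)
    show "(\<lambda>y. f (x + y) * h y) integrable_on cbox a b"
      by (intro integrable_continuous continuous_intros continuous_on_translate f' h')
  qed auto
  \<comment> \<open>Evaluation at \<open>v\<close> is bounded linear, hence commutes with the
    operator-valued integral.\<close>
  moreover have "blinfun_apply (integral (cbox a b) (\<lambda>y. h y *\<^sub>R F (x + y))) v =
      conv_on a b (dir_deriv v f) h x" for v
  proof -
    have "(\<lambda>y. h y *\<^sub>R F (x + y)) integrable_on cbox a b"
      by (intro integrable_continuous continuous_intros continuous_on_translate F_cont h')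
    from integral_linear[OF this blinfun.bounded_linear_left[of v]]
    show ?thesis
      by (simp add: conv_on_def o_def blinfun.scaleR_left F_apply mult.commute)
  qed
  ultimately show ?thesis
    unfolding conv_on_def[abs_def] by (metis (no_types, lifting) has_derivative_eq_rhs ext)
qed

lemma C_k_conv_on:
  assumes "continuous_on UNIV h"
  shows "C_k k f \<Longrightarrow> C_k k (conv_on a b f h)"
proof (induction k arbitrary: f)
  case 0
  then have f: "continuous_on UNIV f" by simp
  have "continuous_on (UNIV \<times> cbox a b) (\<lambda>(x, y). f (x + y) * h y)"
    unfolding split_beta
    by (intro continuous_intros continuous_on_compose2[OF f] continuous_on_compose2[OF assms]) auto
  from integral_continuous_on_param[OF this] show ?case
    by (simp add: conv_on_def[abs_def])
next
  case (Suc k)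
  show ?case
    by (rule C_k_Suc_I[OF has_derivative_conv_on[OF Suc.prems assms]])
      (intro Suc.IH C_k_dir_deriv Suc.prems)
qed

text \<open>By translation invariance, the integral of \<open>\<lambda>y. h (s v + y)\<close> over a large
  box does not depend on small \<open>s\<close>; the claim is the vanishing of its derivative at \<open>s = 0\<close>.\<close>

lemma integral_dir_deriv_compact_support:
  assumes h: "C_k (Suc k) h" and supp: "\<And>y. y \<notin> cbox a b \<Longrightarrow> h y = 0"
  shows "integral (cbox a b) (dir_deriv v h) = 0"
proof -
  \<comment> \<open>By compactness a single box \<open>cbox (-c) c\<close> contains the translates
    of \<open>cbox a b\<close> by \<open>- s *\<^sub>R v\<close> for all \<open>s\<close> between -1
    and 1.\<close>
  have "bounded ((\<lambda>(s, y). y - s *\<^sub>R v) ` ({-1..1} \<times> cbox a b))"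
    unfolding split_beta
    by (intro compact_imp_bounded compact_continuous_image continuous_intros compact_Times compact_cbox) simp
  then obtain c where c: "(\<lambda>(s, y). y - s *\<^sub>R v) ` ({-1..1} \<times> cbox a b) \<subseteq> cbox (-c) c"
    using bounded_subset_cbox_symmetric by blast
  have shift: "y - s *\<^sub>R v \<in> cbox (-c) c" if "\<bar>s\<bar> \<le> 1" "y \<in> cbox a b" for s y
    using subsetD[OF c image_eqI[of _ _ "(s, y)"]] that by (simp add: abs_le_iff)
  have sub: "cbox a b \<subseteq> cbox (-c) c"
    using shift[of 0] by auto
  have h_cont: "continuous_on S h" for S
    using C_k_continuous_on[OF h] .
  define I where "I = integral (cbox a b) h"
  have hI: "(h has_integral I) (cbox a b)"
    unfolding I_def by (intro integrable_integral integrable_continuous h_cont)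
  have const: "conv_on (-c) c h (\<lambda>_. 1) (s *\<^sub>R v) = I" if "\<bar>s\<bar> \<le> 1" for s
  proof -
    let ?Q = "cbox (a - s *\<^sub>R v) (b - s *\<^sub>R v)"
    have "((\<lambda>y. h (y + s *\<^sub>R v)) has_integral I) ?Q"
      using has_integral_affinity'[OF hI, of 1 "s *\<^sub>R v"] by simp
    then have int: "((\<lambda>y. h (s *\<^sub>R v + y)) has_integral I) ?Q"
      by (simp only: add.commute)
    have mem: "y \<in> ?Q \<longleftrightarrow> s *\<^sub>R v + y \<in> cbox a b" for y
      by (simp add: mem_box inner_diff_left inner_add_left algebra_simps)
    have "((\<lambda>y. h (s *\<^sub>R v + y)) has_integral I) (cbox (-c) c)"
    proof (rule has_integral_on_superset[OF int])
      show "h (s *\<^sub>R v + y) = 0" if "y \<notin> ?Q" for y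
        using that supp mem by blast
      show "?Q \<subseteq> cbox (-c) c"
      proof
        fix y assume "y \<in> ?Q"
        then have "s *\<^sub>R v + y \<in> cbox a b"
          using mem by blast
        from shift[OF that this] show "y \<in> cbox (-c) c"
          by (simp only: add_diff_cancel_left')
      qed
    qed
    then show ?thesis
      by (simp add: conv_on_def integral_unique)
  qed
  \<comment> \<open>The derivative at \<open>s = 0\<close> is computed twice: under the integral
    sign, and as that of a function constant near 0.\<close>
  have lin: "((\<lambda>s. s *\<^sub>R v) has_derivative (\<lambda>s. s *\<^sub>R v)) (at 0)"
    by (auto intro!: derivative_eq_intros)
  have "((\<lambda>s. conv_on (-c) c h (\<lambda>_. 1) (s *\<^sub>R v)) has_derivative
      (\<lambda>s. conv_on (-c) c (dir_deriv (s *\<^sub>R v) h) (\<lambda>_. 1) 0)) (at 0)"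
    using has_derivative_compose[OF lin has_derivative_conv_on[OF h, of "\<lambda>_. 1" "-c" c]] by simp
  moreover have "((\<lambda>s. conv_on (-c) c h (\<lambda>_. 1) (s *\<^sub>R v)) has_derivative (\<lambda>s. 0)) (at 0)"
    by (rule has_derivative_transform_within_open[of "\<lambda>s. I" _ _ _ "ball 0 1"]) (auto simp: const)
  ultimately have "conv_on (-c) c (dir_deriv (1 *\<^sub>R v) h) (\<lambda>_. 1) 0 = 0"
    using has_derivative_unique[THEN fun_cong[where x = 1]] by blast
  then have 0: "integral (cbox (-c) c) (dir_deriv v h) = 0"
    by (simp add: conv_on_def)
  \<comment> \<open>Back to the original box: \<open>h\<close> is zero on the open complement of
    \<open>cbox a b\<close>, hence so is its derivative.\<close>
  have "dir_deriv v h y = 0" if "y \<notin> cbox a b" for y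
  proof -
    have "(h has_derivative (\<lambda>_. 0)) (at y)"
      by (rule has_derivative_transform_within_open[of "\<lambda>s. 0" _ _ _ "- cbox a b"])
        (use that in \<open>auto simp: supp closed_cbox\<close>)
    then show ?thesis
      using frechet_derivative_at by metis
  qed
  moreover have "(dir_deriv v h) integrable_on cbox a b"
    by (intro integrable_continuous C_k_continuous_on[OF C_k_dir_deriv[OF h]])
  ultimately have "(dir_deriv v h has_integral integral (cbox a b) (dir_deriv v h)) (cbox (-c) c)"
    using sub by (intro has_integral_on_superset[OF integrable_integral]) auto
  with 0 show ?thesis
    by (simp add: integral_unique)
qed

section \<open>Harmonic functions are smooth\<close>

lemma has_real_derivative_max_0_power:
  "((\<lambda>s::real. max 0 s ^ (m + 2)) has_real_derivative real (m + 2) * max 0 s ^ (m + 1)) (at s)"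
proof (cases s "0::real" rule: linorder_cases)
  case less
  have "((\<lambda>s::real. max 0 s ^ (m + 2)) has_real_derivative 0) (at s)"
    by (rule has_field_derivative_transform_within_open[of "\<lambda>s. 0" _ _ "{..<0}"])
      (use less in \<open>auto simp: max_def\<close>)
  with less show ?thesis by (simp add: max_def)
next
  case greater
  have "((\<lambda>s::real. s ^ (m + 2)) has_real_derivative real (m + 2) * s ^ (m + 1)) (at s)"
    using DERIV_pow[of "m + 2" s] by simp
  then have "((\<lambda>s::real. max 0 s ^ (m + 2)) has_real_derivative real (m + 2) * s ^ (m + 1)) (at s)"
    by (rule has_field_derivative_transform_within_open[where S = "{0<..}"])
      (use greater in \<open>auto simp: max_def\<close>)
  with greater show ?thesis by (simp add: max_def)
next
  \<comment> \<open>At the corner it matters that the exponent is at least 2: the difference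
    quotient is then bounded by a positive power of the increment.\<close>
  case equal
  have "((\<lambda>h::real. max 0 h ^ (m + 2) / h) \<longlongrightarrow> 0) (at 0)"
  proof (rule Lim_null_comparison)
    have "norm (max 0 h ^ (m + 2) / h) \<le> \<bar>h\<bar> ^ (m + 1)" for h :: real
      by (cases "h > 0") (auto simp: max_def mult_nonpos_nonneg)
    then show "\<forall>\<^sub>F h in at 0. norm (max 0 h ^ (m + 2) / h) \<le> \<bar>h\<bar> ^ (m + 1)"
      by simp
    have "((\<lambda>h::real. \<bar>h\<bar> ^ (m + 1)) \<longlongrightarrow> \<bar>0\<bar> ^ (m + 1)) (at 0)"
      by (intro tendsto_intros)
    then show "((\<lambda>h::real. \<bar>h\<bar> ^ (m + 1)) \<longlongrightarrow> 0) (at 0)"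
      by simp
  qed
  with equal show ?thesis by (simp add: DERIV_def)
qed

text \<open>The exponent is a parameter because differentiation lowers it: the gradient of
  \<open>bump (m + 2)\<close> at \<open>y\<close> is a multiple of \<open>bump (m + 1) y\<close>
  times \<open>y\<close>. For \<open>m > 0\<close> the support is the closed unit ball;
  \<open>bump 0\<close> is the constant 1.\<close>

definition bump :: "nat \<Rightarrow> 'a::euclidean_space \<Rightarrow> real" where
  "bump m y = max 0 (1 - y \<bullet> y) ^ m"

lemma continuous_on_bump: "continuous_on S (bump m)"
  unfolding bump_def[abs_def] by (intro continuous_intros)

lemma has_derivative_bump:
  "(bump (m + 2) has_derivative (\<lambda>v. - 2 * real (m + 2) * (y \<bullet> v) * bump (m + 1) y)) (at y)"
proof -
  have "((\<lambda>y. 1 - y \<bullet> y) has_derivative (\<lambda>v. - 2 * (y \<bullet> v))) (at y)"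
    by (auto intro!: derivative_eq_intros simp: inner_commute)
  from has_derivative_compose[OF this
      has_real_derivative_max_0_power[unfolded has_field_derivative_def]]
  show ?thesis
    by (simp add: bump_def[abs_def] algebra_simps)
qed

lemma dir_deriv_bump:
  "dir_deriv v (bump (m + 2)) y = - 2 * real (m + 2) * (y \<bullet> v) * bump (m + 1) y"
  using frechet_derivative_at[OF has_derivative_bump[of m y], symmetric] by simp

lemma C_k_bump: "C_k (Suc 0) (bump (m + 2))"
  by (rule C_k_Suc_I[OF has_derivative_bump])
    (simp, intro continuous_intros continuous_on_bump)

text \<open>The box circumscribes the unit ball: outside it some coordinate exceeds 1 in absolute
  value, so \<open>1 - y \<bullet> y\<close> is negative.\<close>

lemma bump_eq_0:
  assumes "y \<notin> cbox (- One) One" "m > 0"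
  shows "bump m y = 0"
proof -
  obtain i where "i \<in> Basis" "\<bar>y \<bullet> i\<bar> > 1"
    using assms(1) by (force simp: mem_box)
  then have "norm y > 1"
    using Basis_le_norm[of i y] by simp
  then have "y \<bullet> y > 1"
    by (simp add: dot_square_norm power2_eq_square less_1_mult)
  with assms(2) show ?thesis
    by (simp add: bump_def max_def)
qed

text \<open>A continuous nonnegative function with integral 0 would vanish, but the value at the
  origin is 1. Positivity allows division by this constant in the mean value identity.\<close>

lemma integral_bump_pos: "integral (cbox (- One) One) (bump m :: 'a::euclidean_space \<Rightarrow> real) > 0"
proof -
  let ?Q = "cbox (- One) One :: 'a set"
  have int: "(bump m has_integral integral ?Q (bump m)) ?Q"
    by (intro integrable_integral integrable_continuous continuous_on_bump)
  have nonneg: "bump m y \<ge> 0" for y :: 'a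
    by (simp add: bump_def)
  have "integral ?Q (bump m) \<noteq> 0"
  proof
    assume "integral ?Q (bump m) = 0"
    with int have "(bump m has_integral 0) ?Q" by simp
    from has_integral_0_cbox_imp_0[OF continuous_on_bump nonneg this, of 0]
    have "bump m (0::'a) = 0"
      by (simp add: mem_box box_ne_empty)
    then show False by (simp add: bump_def)
  qed
  moreover have "integral ?Q (bump m) \<ge> 0"
    using has_integral_nonneg[OF int] nonneg by blast
  ultimately show ?thesis by simp
qed

section \<open>The mean value identity for harmonic functions\<close>

lemma frechet_derivative_sum_Basis:
  assumes "C_k (Suc k) f"
  shows "frechet_derivative f (at x) y = (\<Sum>i\<in>Basis. (y \<bullet> i) * dir_deriv i f x)"
proof -
  have lin: "linear (frechet_derivative f (at x))"
    using has_derivative_frechet[OF assms] has_derivative_linear by blast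
  have "frechet_derivative f (at x) y = frechet_derivative f (at x) (\<Sum>i\<in>Basis. (y \<bullet> i) *\<^sub>R i)"
    by (simp add: euclidean_representation)
  also have "\<dots> = (\<Sum>i\<in>Basis. (y \<bullet> i) * dir_deriv i f x)"
    by (simp add: linear_sum[OF lin] linear_scale[OF lin])
  finally show ?thesis .
qed

text \<open>The integral of \<open>\<lambda>y. f (x + r y) * bump 2 y\<close> does not depend on \<open>r\<close>: since
  \<open>y * bump 2 y\<close> is a multiple of the gradient of \<open>bump 3\<close>, integration by parts turns its derivative
  into an integral of the Laplacian of \<open>f\<close>.\<close>

lemma mean_value_bump:
  fixes f :: "'a::euclidean_space \<Rightarrow> real"
  assumes f: "C_k 2 f" and harm: "\<And>x. (\<Sum>i\<in>Basis. dir_deriv i (dir_deriv i f) x) = 0"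
  shows "conv_on (- One) One f (bump 2) x = f x * integral (cbox (- One) One) (bump 2 :: 'a \<Rightarrow> real)"
proof -
  let ?Q = "cbox (- One) One :: 'a set"
  \<comment> \<open>\<open>\<phi> 0\<close> is the right-hand side of the claim and
    \<open>\<phi> 1\<close> the left-hand side; \<open>\<psi> r\<close> is the derivative in
    \<open>r\<close> of the integrand.\<close>
  define \<phi> where "\<phi> r = integral ?Q (\<lambda>y. f (x + r *\<^sub>R y) * bump 2 y)" for r
  define \<psi> where "\<psi> r y = (\<Sum>i\<in>Basis. (y \<bullet> i) * dir_deriv i f (x + r *\<^sub>R y)) * bump 2 y" for r y
  have f2: "C_k (Suc (Suc 0)) f"
    using f by (simp add: numeral_2_eq_2)
  have Df: "C_k (Suc 0) (dir_deriv i f)" for i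
    by (rule C_k_dir_deriv[OF f2])
  have int_\<psi>: "integral ?Q (\<psi> r) = 0" for r
  proof -
    have lin: "bounded_linear (\<lambda>y::'a. r *\<^sub>R y)"
      by (rule bounded_linear_scaleR_right)
    \<comment> \<open>\<open>H i\<close> is the component along \<open>i\<close> of a vector field
      supported in the box: the gradient of \<open>f\<close> at \<open>x + r *\<^sub>R y\<close>,
      times \<open>bump 3 y\<close>. Its divergence is \<open>- 6 * \<psi> r y\<close> plus a
      multiple of the Laplacian of \<open>f\<close>, which is 0; the 6 is 2 times the exponent
      3.\<close>
    define H where "H i y = dir_deriv i f (x + r *\<^sub>R y) * bump 3 y" for i y
    have bump3: "C_k (Suc 0) (bump 3 :: 'a \<Rightarrow> real)"
      using C_k_bump[of 1] by (simp add: numeral_3_eq_3)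
    have Dbump3: "dir_deriv v (bump 3) y = - 6 * (y \<bullet> v) * bump 2 y" for v y :: 'a
      using dir_deriv_bump[where m = 1 and v = v and y = y] by (simp add: numeral_3_eq_3 numeral_2_eq_2)
    have H: "C_k (Suc 0) (H i)" for i
      unfolding H_def[abs_def] by (intro C_k_mult C_k_compose_affine[OF lin] Df bump3)
    have DH: "dir_deriv i (H i) y = - 6 * ((y \<bullet> i) * dir_deriv i f (x + r *\<^sub>R y)) * bump 2 y
        + r * dir_deriv i (dir_deriv i f) (x + r *\<^sub>R y) * bump 3 y" for i y
    proof -
      have "dir_deriv (r *\<^sub>R i) (dir_deriv i f) z = r * dir_deriv i (dir_deriv i f) z" for z
        using linear_scale[OF has_derivative_linear[OF has_derivative_frechet[OF Df]]] by simp
      then show ?thesis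
        unfolding H_def[abs_def]
        by (simp add: dir_deriv_mult[OF C_k_compose_affine[OF lin Df] bump3]
            dir_deriv_compose_affine[OF lin Df] Dbump3 del: C_k.simps)
    qed
    have "integral ?Q (dir_deriv i (H i)) = 0" for i
      by (rule integral_dir_deriv_compact_support[OF H]) (simp add: H_def bump_eq_0)
    moreover have "dir_deriv i (H i) integrable_on ?Q" for i
      by (intro integrable_continuous C_k_continuous_on[OF C_k_dir_deriv[OF H]])
    ultimately have "integral ?Q (\<lambda>y. \<Sum>i\<in>Basis. dir_deriv i (H i) y) = 0"
      by (simp add: integral_sum)
    moreover have "(\<Sum>i\<in>Basis. dir_deriv i (H i) y) = - 6 * \<psi> r y" for y
    proof -
      have "(\<Sum>i\<in>Basis. dir_deriv i (H i) y) =
          - 6 * (\<Sum>i\<in>Basis. (y \<bullet> i) * dir_deriv i f (x + r *\<^sub>R y)) * bump 2 y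
          + r * (\<Sum>i\<in>Basis. dir_deriv i (dir_deriv i f) (x + r *\<^sub>R y)) * bump 3 y"
        unfolding DH by (simp only: sum.distrib sum_distrib_left sum_distrib_right)
      then show ?thesis
        by (simp add: harm \<psi>_def)
    qed
    ultimately show ?thesis by simp
  qed
  have "(\<phi> has_real_derivative 0) (at r)" for r
  proof -
    have "((\<lambda>r. integral ?Q (\<lambda>y. f (x + r *\<^sub>R y) * bump 2 y)) has_real_derivative
        integral ?Q (\<psi> r)) (at r within UNIV)"
    proof (rule leibniz_rule_field_derivative)
      fix r y
      have "((\<lambda>r. x + r *\<^sub>R y) has_derivative (\<lambda>s. s *\<^sub>R y)) (at r)"
        by (auto intro!: derivative_eq_intros)
      from has_derivative_compose[OF this has_derivative_frechet[OF f2]]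
      have "((\<lambda>r. f (x + r *\<^sub>R y)) has_derivative
          (\<lambda>s. s * (\<Sum>i\<in>Basis. (y \<bullet> i) * dir_deriv i f (x + r *\<^sub>R y)))) (at r)"
        by (simp only: frechet_derivative_sum_Basis[OF f2, of _ "_ *\<^sub>R y"] inner_scaleR_left
            sum_distrib_left mult.assoc)
      then have "((\<lambda>r. f (x + r *\<^sub>R y)) has_real_derivative
          (\<Sum>i\<in>Basis. (y \<bullet> i) * dir_deriv i f (x + r *\<^sub>R y))) (at r)"
        by (simp add: has_field_derivative_def mult.commute[of _ "sum _ _"])
      then show "((\<lambda>r. f (x + r *\<^sub>R y) * bump 2 y) has_real_derivative \<psi> r y) (at r within UNIV)"
        unfolding \<psi>_def by (rule DERIV_cmult_right)
    next
      fix r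
      show "(\<lambda>y. f (x + r *\<^sub>R y) * bump 2 y) integrable_on ?Q"
        by (intro integrable_continuous continuous_intros continuous_on_bump
            continuous_on_compose2[OF C_k_continuous[OF f]]) auto
    next
      show "continuous_on (UNIV \<times> ?Q) (\<lambda>(r, y). \<psi> r y)"
        unfolding \<psi>_def split_beta
        by (intro continuous_intros continuous_on_compose2[OF continuous_on_bump[of UNIV]]
            continuous_on_compose2[OF C_k_continuous[OF Df]]) auto
    qed auto
    then show ?thesis
      by (simp add: int_\<psi> \<phi>_def[abs_def])
  qed
  then have "\<phi> 1 = \<phi> 0"
    using DERIV_isconst_all by blast
  then show ?thesis
    by (simp add: \<phi>_def conv_on_def)
qed

text \<open>In the mean value identity the derivatives of \<open>f\<close> can be moved to the kernel, so each of them
  is as regular as \<open>f\<close> itself.\<close>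

lemma C_k_Suc_of_mean_value:
  fixes f :: "'a::euclidean_space \<Rightarrow> real"
  assumes f: "C_k (Suc k) f"
    and mean: "\<And>x. conv_on (- One) One f (bump 2) x = f x * c" and "c \<noteq> 0"
  shows "C_k (Suc (Suc k)) f"
proof -
  let ?Q = "cbox (- One) One :: 'a set"
  have K: "C_k (Suc 0) (bump 2 :: 'a \<Rightarrow> real)"
    using C_k_bump[of 0] by (simp add: numeral_2_eq_2)
  have f1: "C_k (Suc 0) f"
    using f by (induction k) (auto dest: C_k_SucD simp del: C_k.simps)
  \<comment> \<open>Integration by parts: the product of the shifted \<open>f\<close> with
    \<open>bump 2\<close> vanishes outside the box, so its derivative integrates to 0.\<close>
  have parts: "conv_on (- One) One (dir_deriv v f) (bump 2) x =
      - conv_on (- One) One f (dir_deriv v (bump 2)) x" for v x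
  proof -
    have f_shift: "C_k (Suc 0) (\<lambda>y. f (x + y))"
      by (rule C_k_compose_affine[OF bounded_linear_ident f1])
    have D: "dir_deriv v (\<lambda>y. f (x + y) * bump 2 y) y =
        f (x + y) * dir_deriv v (bump 2) y + dir_deriv v f (x + y) * bump 2 y" for y
      by (simp only: dir_deriv_mult[OF f_shift K] dir_deriv_compose_affine[OF bounded_linear_ident f1])
    have "integral ?Q (dir_deriv v (\<lambda>y. f (x + y) * bump 2 y)) = 0"
      by (rule integral_dir_deriv_compact_support[OF C_k_mult[OF f_shift K]]) (simp add: bump_eq_0)
    moreover have "(\<lambda>y. f (x + y) * dir_deriv v (bump 2) y) integrable_on ?Q"
      by (intro integrable_continuous continuous_intros C_k_continuous_on[OF f_shift]
          C_k_continuous_on[OF C_k_dir_deriv[OF K]])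
    moreover have "(\<lambda>y. dir_deriv v f (x + y) * bump 2 y) integrable_on ?Q"
      by (intro integrable_continuous continuous_intros continuous_on_bump
          continuous_on_translate C_k_continuous[OF C_k_dir_deriv[OF f1]])
    ultimately show ?thesis
      by (simp add: D conv_on_def integral_add)
  qed
  \<comment> \<open>After division by \<open>c\<close>, the function differentiated here is
    \<open>f\<close> itself, by \<open>mean\<close>.\<close>
  have "((\<lambda>x. conv_on (- One) One f (bump 2) x * (1 / c)) has_derivative
      (\<lambda>v. conv_on (- One) One (dir_deriv v f) (bump 2) x * (1 / c))) (at x)" for x
    by (intro has_derivative_mult_left has_derivative_conv_on[OF f continuous_on_bump])
  then have "(f has_derivative
      (\<lambda>v. conv_on (- One) One f (dir_deriv v (bump 2)) x * (- 1 / c))) (at x)" for x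
    using \<open>c \<noteq> 0\<close> by (simp add: mean parts)
  \<comment> \<open>The differentiated kernel is merely continuous, which is all that
    \<open>C_k_conv_on\<close> asks of it.\<close>
  then show ?thesis
    by (rule C_k_Suc_I)
      (intro C_k_mult C_k_const C_k_conv_on f C_k_continuous[OF C_k_dir_deriv[OF K]])
qed

text \<open>Bootstrapping: $C^2$ regularity gives the mean value identity once and for all, and each
  further use of it gains one derivative.\<close>

lemma smooth_of_harmonic:
  fixes b :: "real^'n::finite \<Rightarrow> real"
  assumes "harmonic b"
  shows "smooth b"
proof -
  have b: "C_k (Suc (Suc 0)) b"
    using assms by (simp add: harmonic_def numeral_2_eq_2)
  \<comment> \<open>Reindexing coordinates by the basis vectors \<open>axis i 1\<close> turns
    \<open>laplacian\<close> into the sum over \<open>Basis\<close> used in the mean value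
    identity.\<close>
  have inj: "inj (\<lambda>i::'n. axis i (1::real))"
    by (auto simp: inj_on_def axis_eq_axis)
  have Basis_eq: "(Basis :: (real^'n) set) = range (\<lambda>i. axis i 1)"
    by (auto simp: Basis_vec_def)
  have "(\<Sum>i\<in>Basis. dir_deriv i (dir_deriv i b) x) = laplacian b x" for x
    unfolding Basis_eq laplacian_def partial_deriv_def[abs_def] sum.reindex[OF inj] by simp
  then have mean: "conv_on (- One) One b (bump 2) x =
      b x * integral (cbox (- One) One) (bump 2 :: real^'n \<Rightarrow> real)" for x
    using assms by (intro mean_value_bump) (simp_all add: harmonic_def)
  have "C_k (Suc k) b" for k
  proof (induction k)
    case 0
    show ?case using C_k_SucD[OF b] .
  next
    case (Suc k)
    show ?case
      by (rule C_k_Suc_of_mean_value[OF Suc mean less_imp_neq[OF integral_bump_pos, symmetric]])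
  qed
  then show ?thesis
    unfolding smooth_def using C_k_SucD by blast
qed

section \<open>Donaldson's equation\<close>

lemma smooth_Pair_polynomial:
  fixes b g :: "real^'n::finite \<Rightarrow> real"
  assumes "smooth b" "smooth g"
  shows "smooth (\<lambda>p. a * (fst p)\<^sup>2 + fst p * b (snd p) + g (snd p))"
proof -
  \<comment> \<open>Writing the square as a product and inserting \<open>0 +\<close> brings each
    term into the shape of a closure lemma.\<close>
  have "C_k k (\<lambda>p. a * (fst p * fst p) + fst p * b (0 + snd p) + g (0 + snd p))" for k
    using assms
    by (intro C_k_add C_k_mult C_k_const C_k_linear[OF bounded_linear_fst]
        C_k_compose_affine[OF bounded_linear_snd]) (auto simp: smooth_def)
  then show ?thesis
    by (simp add: smooth_def power2_eq_square)
qed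

text \<open>At fixed time \<open>t\<close> the quadratic term of the solution is constant in space;
  it is the \<open>c\<close> here.\<close>

lemma laplacian_affine_combination:
  assumes "C_k (Suc (Suc 0)) b" "C_k (Suc (Suc 0)) g"
  shows "laplacian (\<lambda>y. c + t * b y + g y) x = t * laplacian b x + laplacian g x"
proof -
  have partial: "partial_deriv i (\<lambda>y. c + t * f y + h y) = (\<lambda>y. t * partial_deriv i f y + partial_deriv i h y)"
    if f: "C_k (Suc 0) f" and h: "C_k (Suc 0) h" for i c and f h :: "real^'a \<Rightarrow> real"
  proof
    fix y
    have "((\<lambda>y. c + t * f y + h y) has_derivative
        (\<lambda>v. t * frechet_derivative f (at y) v + frechet_derivative h (at y) v)) (at y)"
      by (auto intro!: derivative_eq_intros has_derivative_frechet[OF f] has_derivative_frechet[OF h])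
    from frechet_derivative_at[OF this, symmetric]
    show "partial_deriv i (\<lambda>y. c + t * f y + h y) y = t * partial_deriv i f y + partial_deriv i h y"
      by (simp add: partial_deriv_def)
  qed
  have C1: "C_k (Suc 0) (partial_deriv i f)" if "C_k (Suc (Suc 0)) f" for i and f :: "real^'a \<Rightarrow> real"
    unfolding partial_deriv_def[abs_def] by (rule C_k_dir_deriv[OF that])
  \<comment> \<open>\<open>partial\<close> is applied twice; the first derivative has removed the
    constant, hence the \<open>0\<close>.\<close>
  show ?thesis
    unfolding laplacian_def partial[OF C_k_SucD[OF assms(1)] C_k_SucD[OF assms(2)]]
    using partial[OF C1[OF assms(1)] C1[OF assms(2)], of _ 0]
    by (simp add: sum.distrib sum_distrib_left)
qed

text \<open>Both functions have the same derivatives at \<open>x\<close>, so the choice behind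
  \<open>frechet_derivative\<close> agrees even where \<open>f\<close> is not
  differentiable.\<close>

lemma gradient_add_const: "gradient (\<lambda>y. c + f y) x = gradient f x"
proof -
  have "((\<lambda>y. c + f y) has_derivative F) (at x) \<longleftrightarrow> (f has_derivative F) (at x)" for F
  proof
    assume "((\<lambda>y. c + f y) has_derivative F) (at x)"
    from has_derivative_diff[OF this has_derivative_const[of c]]
    show "(f has_derivative F) (at x)" by simp
  next
    assume "(f has_derivative F) (at x)"
    from has_derivative_add[OF has_derivative_const[of c] this]
    show "((\<lambda>y. c + f y) has_derivative F) (at x)" by simp
  qed
  then show ?thesis
    by (simp add: gradient_def partial_deriv_def frechet_derivative_def)
qed

text \<open>Here u_tt is \<open>2 * a\<close>, the gradient of u_t is that of \<open>b\<close>, and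
  harmonicity of \<open>b\<close> reduces the Laplacian of \<open>u\<close> to that of
  \<open>g\<close>. Its factor \<open>1 / (2 * a)\<close> cancels u_tt, and the two squared
  gradients cancel.\<close>

lemma entire_donaldson_solution_quadratic:
  fixes b g :: "real^'n::finite \<Rightarrow> real"
  assumes "a > 0" and b: "harmonic b" and g: "smooth g"
    and lap: "\<And>x. laplacian g x = 1 / (2 * a) * (1 + (norm (gradient b x))\<^sup>2)"
    and u: "\<And>t x. u (t, x) = a * t\<^sup>2 + t * b x + g x"
  shows "entire_donaldson_solution u"
proof -
  have "u = (\<lambda>p. a * (fst p)\<^sup>2 + fst p * b (snd p) + g (snd p))"
    using u by auto
  then have "smooth u"
    using smooth_Pair_polynomial[OF smooth_of_harmonic[OF b] g] by simp
  have ut: "time_deriv u = (\<lambda>(t, x). 2 * a * t + b x)"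
  proof (rule ext, clarify)
    fix t x
    have "((\<lambda>s. u (s, x)) has_real_derivative 2 * a * t + b x) (at t)"
      unfolding u by (auto intro!: derivative_eq_intros)
    then show "time_deriv u (t, x) = 2 * a * t + b x"
      by (simp add: time_deriv_def DERIV_imp_deriv)
  qed
  have utt: "time_deriv (time_deriv u) p = 2 * a" for p
  proof (cases p)
    case (Pair t x)
    have "((\<lambda>s. 2 * a * s + b x) has_real_derivative 2 * a) (at t)"
      by (auto intro!: derivative_eq_intros)
    then show ?thesis
      by (simp add: Pair ut time_deriv_def[of "\<lambda>(t, x). _ t x"] DERIV_imp_deriv)
  qed
  have grad: "space_gradient (time_deriv u) (t, x) = gradient b x" for t x
    by (simp add: space_gradient_def ut gradient_add_const)
  have "C_k (Suc (Suc 0)) b" "C_k (Suc (Suc 0)) g"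
    using smooth_of_harmonic[OF b] g unfolding smooth_def by blast+
  from laplacian_affine_combination[OF this]
  have lapu: "space_laplacian u (t, x) = 1 / (2 * a) * (1 + (norm (gradient b x))\<^sup>2)" for t x
    using b by (simp add: space_laplacian_def u harmonic_def lap)
  have "1 + (norm (gradient b x))\<^sup>2 > 0" for x
    by (simp add: add_pos_nonneg)
  with \<open>a > 0\<close> \<open>smooth u\<close> show ?thesis
    by (auto simp: entire_donaldson_solution_def utt grad lapu)
qed

section \<open>Solutions with constant second time derivative\<close>

lemma has_real_derivative_time:
  assumes "smooth u"
  shows "((\<lambda>s. u (s, x)) has_real_derivative time_deriv u (t, x)) (at t)"
    and "time_deriv u (t, x) = dir_deriv (1, 0) u (t, x)"
proof -
  have u: "C_k (Suc 0) u"
    using assms unfolding smooth_def by blast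
  \<comment> \<open>The chain rule along the time line through \<open>x\<close> identifies the time
    derivative with the Frechet derivative in direction \<open>(1, 0)\<close>.\<close>
  have "((\<lambda>s. (s, x)) has_derivative (\<lambda>s. (s, 0))) (at t)"
    by (auto intro!: derivative_eq_intros)
  from has_derivative_compose[OF this has_derivative_frechet[OF u]]
  have D: "((\<lambda>s. u (s, x)) has_derivative (\<lambda>s. frechet_derivative u (at (t, x)) (s, 0))) (at t)" .
  have "(\<lambda>s. frechet_derivative u (at (t, x)) (s, 0)) = (*) (dir_deriv (1, 0) u (t, x))"
  proof
    fix s
    show "frechet_derivative u (at (t, x)) (s, 0) = dir_deriv (1, 0) u (t, x) * s"
      using linear_scale[OF has_derivative_linear[OF has_derivative_frechet[OF u]], where r = s and b = "(1, 0)"]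
      by simp
  qed
  with D have D': "((\<lambda>s. u (s, x)) has_real_derivative dir_deriv (1, 0) u (t, x)) (at t)"
    unfolding has_field_derivative_def by (rule has_derivative_eq_rhs)
  then show "time_deriv u (t, x) = dir_deriv (1, 0) u (t, x)"
    by (simp add: time_deriv_def DERIV_imp_deriv)
  with D' show "((\<lambda>s. u (s, x)) has_real_derivative time_deriv u (t, x)) (at t)"
    by simp
qed

lemma smooth_time_deriv:
  assumes "smooth u"
  shows "smooth (time_deriv u)"
proof -
  have "time_deriv u = dir_deriv (1, 0) u"
    using has_real_derivative_time(2)[OF assms] by (auto simp: fun_eq_iff)
  moreover have "C_k k (dir_deriv (1, 0) u)" for k
    using assms C_k_dir_deriv unfolding smooth_def by blast
  ultimately show ?thesis
    by (simp add: smooth_def)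
qed

text \<open>Two integrations in \<open>t\<close> at fixed \<open>x\<close>; each subtracts the
  expected primitive and uses that a function with zero derivative is constant.\<close>

lemma quadratic_of_constant_second_time_deriv:
  assumes u: "smooth u" and c: "\<And>p. time_deriv (time_deriv u) p = c"
  shows "u (t, x) = c / 2 * t\<^sup>2 + t * time_deriv u (0, x) + u (0, x)"
proof -
  have "((\<lambda>s. time_deriv u (s, x) - c * s) has_real_derivative 0) (at s)" for s
    using DERIV_diff[OF has_real_derivative_time(1)[OF smooth_time_deriv[OF u]] DERIV_cmult_Id[of c]]
    by (simp add: c)
  then have const: "time_deriv u (s, x) - c * s = time_deriv u (0, x) - c * 0" for s
    using DERIV_isconst_all[of "\<lambda>s. time_deriv u (s, x) - c * s"] by blast
  have ut: "time_deriv u (s, x) = c * s + time_deriv u (0, x)" for s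
    using const[of s] by simp
  let ?w = "\<lambda>s. u (s, x) - c / 2 * s\<^sup>2 - s * time_deriv u (0, x)"
  have "(?w has_real_derivative 0) (at s)" for s
  proof -
    have "((\<lambda>s. c / 2 * s\<^sup>2) has_real_derivative c * s) (at s)"
      "((\<lambda>s. s * time_deriv u (0, x)) has_real_derivative time_deriv u (0, x)) (at s)"
      by (auto intro!: derivative_eq_intros)
    from DERIV_diff[OF DERIV_diff[OF has_real_derivative_time(1)[OF u, where x = x] this(1)] this(2)]
    show ?thesis
      by (simp add: ut[of s])
  qed
  then have "?w t = ?w 0"
    using DERIV_isconst_all[of ?w] by blast
  then show ?thesis by simp
qed

theorem theorem2p1:
  shows "(\<forall>(u :: real \<times> (real^'n::finite) \<Rightarrow> real) (a :: real) (b :: real^'n \<Rightarrow> real) (g :: real^'n \<Rightarrow> real).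
            a > 0 \<longrightarrow> harmonic b \<longrightarrow> smooth g \<longrightarrow>
            (\<forall>x. laplacian g x = 1 / (2 * a) * (1 + (norm (gradient b x))\<^sup>2)) \<longrightarrow>
            (\<forall>t x. u (t, x) = a * t\<^sup>2 + t * b x + g x) \<longrightarrow>
            entire_donaldson_solution u)
       \<and> (\<forall>u :: real \<times> (real^'n) \<Rightarrow> real.
            entire_donaldson_solution u \<longrightarrow>
            (\<exists>c. \<forall>p. time_deriv (time_deriv u) p = c) \<longrightarrow>
            (\<exists>(a :: real) (b :: real^'n \<Rightarrow> real) (g :: real^'n \<Rightarrow> real).
               a > 0 \<and> (\<forall>t x. u (t, x) = a * t\<^sup>2 + t * b x + g x)))"
proof (intro conjI allI impI)
  fix u :: "real \<times> (real^'n) \<Rightarrow> real" and a :: real and b g :: "real^'n \<Rightarrow> real"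
  assume "a > 0" "harmonic b" "smooth g"
    "\<forall>x. laplacian g x = 1 / (2 * a) * (1 + (norm (gradient b x))\<^sup>2)"
    "\<forall>t x. u (t, x) = a * t\<^sup>2 + t * b x + g x"
  then show "entire_donaldson_solution u"
    by (intro entire_donaldson_solution_quadratic[of a b g]) auto
next
  fix u :: "real \<times> (real^'n) \<Rightarrow> real"
  assume u: "entire_donaldson_solution u" and "\<exists>c. \<forall>p. time_deriv (time_deriv u) p = c"
  then obtain c where c: "\<And>p. time_deriv (time_deriv u) p = c" by blast
  \<comment> \<open>Positivity of u_tt makes \<open>c / 2\<close>, the witness for \<open>a\<close>,
    positive. The witnesses for \<open>b\<close> and \<open>g\<close> are the values of u_t and
    \<open>u\<close> at time 0.\<close>
  have "c > 0" "smooth u"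
    using u c by (auto simp: entire_donaldson_solution_def)
  moreover have "\<forall>t x. u (t, x) = c / 2 * t\<^sup>2 + t * time_deriv u (0, x) + u (0, x)"
    by (intro allI quadratic_of_constant_second_time_deriv \<open>smooth u\<close> c)
  ultimately show "\<exists>(a :: real) (b :: real^'n \<Rightarrow> real) (g :: real^'n \<Rightarrow> real).
      a > 0 \<and> (\<forall>t x. u (t, x) = a * t\<^sup>2 + t * b x + g x)"
    by (intro exI[of _ "c / 2"] exI[of _ "\<lambda>x. time_deriv u (0, x)"] exI[of _ "\<lambda>x. u (0, x)"] conjI
        half_gt_zero)
qed

end
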